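(* Let $r>0$ be an integer. There exists $\ell_0=\ell_0(r)$ such that for every integer $\ell>\ell_0$, $$f_4(\ell,r)<(10\,\ell\log\ell)^{r+1}.$$
   Context: Graphs are finite, simple and undirected. For a graph $G=(V,E)$, $v\in V$ and a positive integer $r$, the $r$-ball $U_r(v,G)$ is the subgraph of $G$ induced on all vertices at graph distance at most $r$ from $v$. The $r$-local chromatic number of $G$ is $\ell\chi_r(G)=\max_{v\in V}\chi(U_r(v,G))$, where $\chi$ is the chromatic number. For integers $\ell\ge c\ge 2$ and $r>0$, $f_c(\ell,r)$ is the greatest integer $n$ such that every graph on $n$ vertices whose $r$-local chromatic number is at most $c$ is $\ell$-colorable. $\log$ is the natural logarithm. *)

theory Defs
  imports Complex_Main "Graph_Theory.Graph_Theory"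
begin

text \<open>A finite simple undirected graph is a \<^locale>\<open>pair_graph\<close>: a finite, loop-free,
  symmetric digraph without parallel arcs, the edge \<open>uv\<close> being the pair of arcs \<open>(u,v)\<close>, \<open>(v,u)\<close>.\<close>

definition proper_coloring :: "('a, 'b) pre_digraph \<Rightarrow> nat \<Rightarrow> ('a \<Rightarrow> nat) \<Rightarrow> bool" where
  "proper_coloring G k f \<longleftrightarrow>
     f ` verts G \<subseteq> {..<k} \<and> (\<forall>e\<in>arcs G. f (tail G e) \<noteq> f (head G e))"

definition colorable :: "('a, 'b) pre_digraph \<Rightarrow> nat \<Rightarrow> bool" where
  "colorable G k \<longleftrightarrow> (\<exists>f. proper_coloring G k f)"

definition chromatic_number :: "('a, 'b) pre_digraph \<Rightarrow> nat" where
  "chromatic_number G = (LEAST k. colorable G k)"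

text \<open>With unit arc costs, \<^const>\<open>wf_digraph.\<mu>\<close> is the graph distance
  (\<open>\<infinity>\<close> between different components).\<close>

definition graph_dist :: "('a, 'b) pre_digraph \<Rightarrow> 'a \<Rightarrow> 'a \<Rightarrow> ereal" where
  "graph_dist G u v = wf_digraph.\<mu> G (\<lambda>_. 1) u v"

definition graph_ball :: "nat \<Rightarrow> 'a \<Rightarrow> ('a, 'b) pre_digraph \<Rightarrow> ('a, 'b) pre_digraph" where
  "graph_ball r v G = G \<restriction> {u \<in> verts G. graph_dist G v u \<le> ereal (real r)}"

text \<open>On the graph without vertices the maximum is an unspecified number. This does not
  affect \<open>f_loc\<close> below, since that graph is colorable with any number of colors.\<close>

definition local_chromatic_number :: "nat \<Rightarrow> ('a, 'b) pre_digraph \<Rightarrow> nat" where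
  "local_chromatic_number r G = (MAX v\<in>verts G. chromatic_number (graph_ball r v G))"

text \<open>Every graph on \<open>n\<close> vertices is isomorphic to one whose vertices are natural numbers,
  so it suffices to quantify over the latter.\<close>

definition local_forces_colorable :: "nat \<Rightarrow> nat \<Rightarrow> nat \<Rightarrow> nat \<Rightarrow> bool" where
  "local_forces_colorable c l r n \<longleftrightarrow>
     (\<forall>G :: nat pair_pre_digraph.
        pair_graph G \<longrightarrow> card (pverts G) = n \<longrightarrow>
        local_chromatic_number r (with_proj G) \<le> c \<longrightarrow> colorable (with_proj G) l)"

text \<open>\<open>f_loc c l r\<close> is $f_c(\ell,r)$. The value \<open>\<infinity>\<close> stands for the absence of a greatest
  integer (\<open>n = 0\<close> always qualifies, so this can only be due to unboundedness); a strict
  upper bound on \<open>f_loc c l r\<close> thus includes the existence of the greatest integer.\<close>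

definition f_loc :: "nat \<Rightarrow> nat \<Rightarrow> nat \<Rightarrow> enat" where
  "f_loc c l r =
     (if bdd_above {n. local_forces_colorable c l r n}
      then enat (GREATEST n. local_forces_colorable c l r n) else \<infinity>)"

end

theory Submission
  imports Defs "HOL-Real_Asymp.Real_Asymp" "HOL-Analysis.Harmonic_Numbers"
begin

text \<open>
  The proof is probabilistic. Put \<open>L = l * ln l\<close> and let \<open>n\<close> be about \<open>(10 * L) ^ (r + 1)\<close>. In a random graph on \<open>n\<close>
  vertices with average degree about \<open>3 * L\<close>, with high probability no assignment of \<open>l\<close> colours
  to five sixths of the vertices is proper, by the first moment method (\<open>weight_almost_colorable\<close>).

  The ball of radius \<open>r\<close> around a vertex \<open>v\<close> splits into layers according to the distance from \<open>v\<close>.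
  If no layer contains a cycle, then each layer is 2-colorable, and using disjoint pairs of colours for
  even and odd layers, the ball is 4-colorable (\<open>hood_4_colorable\<close>). Otherwise \<open>v\<close> is called bad.
  The adjacencies inside a layer are independent of the way in which the layers arise, and a ball
  has so few vertices, namely at most \<open>(1 + 6 * L) ^ r\<close> if all degrees are at most \<open>6 * L\<close>, that the random graph on
  it has average degree below 1; so it is unlikely that \<open>v\<close> is bad. The precise form of this
  independence is that deleting the edges of a cycle inside a layer does not alter the layers
  (\<open>hood_delete_layer_edges\<close>), which permits a switching argument (\<open>weight_bad\<close>).

  Hence some graph has at most \<open>n / 6\<close> bad vertices, while none of its induced subgraphs
  on at least five sixths of the vertices is \<open>l\<close>-colorable (\<open>ex_good_edge_set\<close>). Isolating its bad vertices yields
  a graph whose balls are all 4-colorable but which is not \<open>l\<close>-colorable, and further isolated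
  vertices extend it to all larger orders (\<open>not_local_forces_colorable\<close>).

  Instead of probabilities, the proof uses finite sums of the weights \<open>q ^ card E\<close> over sets \<open>E\<close> of edges.
\<close>

section \<open>Colouring balls by layers\<close>

text \<open>Graphs are given by their sets \<open>E\<close> of edges, each edge being a set \<open>{u, w}\<close>.
  \<open>hood E v i\<close> is the set of vertices at distance at most \<open>i\<close> from \<open>v\<close>.\<close>

primrec hood :: "'a set set \<Rightarrow> 'a \<Rightarrow> nat \<Rightarrow> 'a set" where
  "hood E v 0 = {v}"
| "hood E v (Suc i) = hood E v i \<union> {w. \<exists>u\<in>hood E v i. {u, w} \<in> E}"

text \<open>\<open>layer E v i\<close> is the sphere of radius \<open>i\<close> around \<open>v\<close>.\<close>

definition layer :: "'a set set \<Rightarrow> 'a \<Rightarrow> nat \<Rightarrow> 'a set" where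
  "layer E v i = {w \<in> hood E v i. \<forall>j<i. w \<notin> hood E v j}"

text \<open>A cycle is the list of its vertices in cyclic order; \<open>cycle_edges\<close> are the edges between
  consecutive entries, including the one from the last entry back to the first.\<close>

definition cycle_edges :: "'a list \<Rightarrow> 'a set set" where
  "cycle_edges xs = (\<lambda>i. {xs ! i, xs ! (Suc i mod length xs)}) ` {..<length xs}"

text \<open>\<open>cycle_in E A xs\<close>: \<open>xs\<close> is a cycle of the graph \<open>E\<close> with all vertices in \<open>A\<close>.\<close>

definition cycle_in :: "'a set set \<Rightarrow> 'a set \<Rightarrow> 'a list \<Rightarrow> bool" where
  "cycle_in E A xs \<longleftrightarrow>
     distinct xs \<and> 3 \<le> length xs \<and> set xs \<subseteq> A \<and> cycle_edges xs \<subseteq> E"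

text \<open>The bound 3 on the length matters: a list of two vertices would trace the same edge twice.\<close>

lemma card_cycle_edges:
  assumes "distinct xs" "3 \<le> length xs"
  shows "card (cycle_edges xs) = length xs"
proof -
  let ?k = "length xs"
  have "inj_on (\<lambda>i. {xs ! i, xs ! (Suc i mod ?k)}) {..<?k}"
  proof (rule inj_onI)
    fix i j assume ij: "i \<in> {..<?k}" "j \<in> {..<?k}"
      and eq: "{xs ! i, xs ! (Suc i mod ?k)} = {xs ! j, xs ! (Suc j mod ?k)}"
    have "0 < ?k" using assms(2) by linarith
    then have lt: "Suc i mod ?k < ?k" "Suc j mod ?k < ?k" by simp_all
    show "i = j"
    proof (rule ccontr)
      assume "i \<noteq> j"
      then have "xs ! i \<noteq> xs ! j" using ij assms(1) by (auto simp: nth_eq_iff_index_eq)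
      then have "xs ! i = xs ! (Suc j mod ?k)" "xs ! j = xs ! (Suc i mod ?k)"
        using eq by (auto simp: doubleton_eq_iff)
      then have *: "i = Suc j mod ?k" "j = Suc i mod ?k"
        using ij lt assms(1) by (auto simp: nth_eq_iff_index_eq)
      \<comment> \<open>The two edges are traced in opposite directions, so each index is the cyclic successor of
        the other; this is impossible when the cycle is longer than 2.\<close>
      have wrap: "Suc x = ?k \<and> Suc x mod ?k = 0 \<or> Suc x mod ?k = Suc x" if "x < ?k" for x
        using that by (cases "Suc x = ?k") simp_all
      have "Suc j = ?k \<and> i = 0 \<or> i = Suc j" "Suc i = ?k \<and> j = 0 \<or> j = Suc i"
        using wrap[of j] wrap[of i] ij unfolding *(1)[symmetric] *(2)[symmetric] by blast+
      then show False using assms(2) by linarith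
    qed
  qed
  then show ?thesis by (simp add: cycle_edges_def card_image)
qed

lemma cycle_edges_subset: "e \<in> cycle_edges xs \<Longrightarrow> e \<subseteq> set xs"
  by (auto simp: cycle_edges_def intro!: nth_mem mod_less_divisor)

text \<open>Take a longest path. Its first vertex has a neighbour other than the second
  vertex, which must lie on the path by maximality and thus closes a cycle.\<close>

lemma ex_cycle_if_min_degree_2:
  assumes "finite A" "A \<noteq> {}"
    and two: "\<And>u. u \<in> A \<Longrightarrow> \<exists>x\<in>A. \<exists>y\<in>A. x \<noteq> y \<and> x \<noteq> u \<and> y \<noteq> u \<and> {u, x} \<in> E \<and> {u, y} \<in> E"
  shows "\<exists>xs. cycle_in E A xs"
proof -
  define path where "path xs \<longleftrightarrow> xs \<noteq> [] \<and> distinct xs \<and> set xs \<subseteq> A \<and>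
    (\<forall>i. Suc i < length xs \<longrightarrow> {xs ! i, xs ! Suc i} \<in> E)" for xs
  obtain a where "a \<in> A" using assms(2) by auto
  then have "path [a]" by (simp add: path_def)
  moreover have "\<forall>xs. path xs \<longrightarrow> length xs \<le> card A"
    unfolding path_def by (metis assms(1) card_mono distinct_card)
  ultimately have "\<exists>xs. path xs \<and> (\<forall>ys. path ys \<longrightarrow> length ys \<le> length xs)"
    by (intro ex_has_greatest_nat[of path "[a]" length "Suc (card A)"]) (auto simp: le_imp_less_Suc)
  then obtain xs where xs: "path xs" and max: "\<And>ys. path ys \<Longrightarrow> length ys \<le> length xs"
    by blast
  then have hd: "xs ! 0 \<in> A" "xs \<noteq> []" by (auto simp: path_def)
  \<comment> \<open>On a path with one vertex, \<open>xs ! 1\<close> is an arbitrary value. Since there are two neighbours to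
    choose from, it can be avoided all the same.\<close>
  obtain y where y: "y \<in> A" "y \<noteq> xs ! 0" "y \<noteq> xs ! 1" "{xs ! 0, y} \<in> E"
    using two[OF hd(1)] by metis
  have "y \<in> set xs"
  proof (rule ccontr)
    assume "y \<notin> set xs"
    then have "path (y # xs)"
      using xs y unfolding path_def by (auto simp: nth_Cons insert_commute split: nat.splits)
    then show False using max[of "y # xs"] by simp
  qed
  then obtain j where j: "j < length xs" "y = xs ! j" by (auto simp: in_set_conv_nth)
  with y have "2 \<le> j" by (metis One_nat_def less_2_cases not_le)
  define ys where "ys = take (Suc j) xs"
  have len: "length ys = Suc j" using j by (simp add: ys_def)
  have "cycle_edges ys \<subseteq> E"
  proof
    fix e assume "e \<in> cycle_edges ys"
    then obtain i where i: "i \<le> j" "e = {ys ! i, ys ! (Suc i mod Suc j)}"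
      unfolding cycle_edges_def len by (metis (no_types, lifting) imageE lessThan_iff less_Suc_eq_le)
    show "e \<in> E"
    proof (cases "i = j")
      case True
      then show ?thesis using i y j by (simp add: ys_def insert_commute)
    next
      case False
      then show ?thesis using i j xs by (simp add: ys_def path_def)
    qed
  qed
  then have "cycle_in E A ys"
    using xs len \<open>2 \<le> j\<close> by (auto simp: cycle_in_def path_def ys_def dest: in_set_takeD)
  then show ?thesis by blast
qed

lemma forest_2_colorable:
  assumes "finite A" "\<nexists>xs. cycle_in E A xs"
  shows "\<exists>c :: 'a \<Rightarrow> bool. \<forall>u\<in>A. \<forall>w\<in>A. u \<noteq> w \<and> {u, w} \<in> E \<longrightarrow> c u \<noteq> c w"
  using assms
proof (induction A rule: finite_psubset_induct)
  case (psubset A)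
  show ?case
  proof (cases "A = {}")
    case False
    then obtain u where u: "u \<in> A" and one: "\<And>x y. x \<in> A \<Longrightarrow> y \<in> A \<Longrightarrow> x \<noteq> u \<Longrightarrow> y \<noteq> u \<Longrightarrow>
        {u, x} \<in> E \<Longrightarrow> {u, y} \<in> E \<Longrightarrow> x = y"
      using ex_cycle_if_min_degree_2[of A E] psubset.hyps psubset.prems by blast
    have "\<nexists>xs. cycle_in E (A - {u}) xs"
      using psubset.prems unfolding cycle_in_def by blast
    then obtain c :: "'a \<Rightarrow> bool" where
      c: "\<And>x w. x \<in> A - {u} \<Longrightarrow> w \<in> A - {u} \<Longrightarrow> x \<noteq> w \<Longrightarrow> {x, w} \<in> E \<Longrightarrow> c x \<noteq> c w"
      using psubset.IH[of "A - {u}"] u by blast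
    define b where "b \<longleftrightarrow> (\<exists>x\<in>A - {u}. {u, x} \<in> E \<and> \<not> c x)"
    have b: "b \<noteq> c x" if "x \<in> A" "x \<noteq> u" "{u, x} \<in> E" for x
      using that one[of x] unfolding b_def by blast
    have "(c(u := b)) x \<noteq> (c(u := b)) w" if "x \<in> A" "w \<in> A" "x \<noteq> w" "{x, w} \<in> E" for x w
      using that c[of x w] b[of x] b[of w] by (auto simp: insert_commute)
    then show ?thesis by blast
  qed auto
qed

lemma hood_mono: "i \<le> j \<Longrightarrow> hood E v i \<subseteq> hood E v j"
  by (rule lift_Suc_mono_le[of "hood E v"]) auto

lemma hood_mono_edges: "E \<subseteq> E' \<Longrightarrow> hood E v i \<subseteq> hood E' v i"
  by (induction i) auto

lemma layer_subset_hood: "i \<le> r \<Longrightarrow> layer E v i \<subseteq> hood E v r"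
  using hood_mono[of i r E v] by (auto simp: layer_def)

text \<open>Edges join vertices in the same layer or in consecutive ones. Hence two colours for the even
  layers and two other colours for the odd layers suffice, once each layer is 2-colorable.\<close>

lemma hood_4_colorable:
  assumes fin: "finite (hood E v r)"
    and acyclic: "\<And>i xs. i \<le> r \<Longrightarrow> \<not> cycle_in E (layer E v i) xs"
  shows "\<exists>f :: 'a \<Rightarrow> nat. (\<forall>u. f u < 4) \<and>
    (\<forall>u\<in>hood E v r. \<forall>w\<in>hood E v r. u \<noteq> w \<and> {u, w} \<in> E \<longrightarrow> f u \<noteq> f w)"
proof -
  have "\<forall>i\<in>{..r}. \<exists>c :: 'a \<Rightarrow> bool. \<forall>u\<in>layer E v i. \<forall>w\<in>layer E v i. u \<noteq> w \<and> {u, w} \<in> E \<longrightarrow> c u \<noteq> c w"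
  proof
    fix i assume "i \<in> {..r}"
    then show "\<exists>c :: 'a \<Rightarrow> bool. \<forall>u\<in>layer E v i. \<forall>w\<in>layer E v i. u \<noteq> w \<and> {u, w} \<in> E \<longrightarrow> c u \<noteq> c w"
      using acyclic finite_subset[OF layer_subset_hood fin] by (intro forest_2_colorable) auto
  qed
  from bchoice[OF this] obtain c :: "nat \<Rightarrow> 'a \<Rightarrow> bool" where
    c: "\<And>i u w. i \<le> r \<Longrightarrow> u \<in> layer E v i \<Longrightarrow> w \<in> layer E v i \<Longrightarrow> u \<noteq> w \<Longrightarrow> {u, w} \<in> E \<Longrightarrow> c i u \<noteq> c i w"
    by auto
  \<comment> \<open>The index of the layer of \<open>u\<close>, that is, the distance from \<open>v\<close>.\<close>
  define lev where "lev u = (LEAST i. u \<in> hood E v i)" for u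
  have lev: "lev u \<le> r \<and> u \<in> layer E v (lev u)" if "u \<in> hood E v r" for u
    using that unfolding lev_def layer_def by (auto intro: LeastI Least_le dest: not_less_Least)
  have lev_Suc: "lev w \<le> Suc (lev u)" if "u \<in> hood E v r" "{u, w} \<in> E" for u w
  proof -
    have "w \<in> hood E v (Suc (lev u))" using lev[OF that(1)] that(2) by (auto simp: layer_def)
    then show ?thesis unfolding lev_def[of w] by (rule Least_le)
  qed
  define f :: "'a \<Rightarrow> nat" where "f u = 2 * (lev u mod 2) + (if c (lev u) u then 1 else 0)" for u
  have "f u < 4" for u unfolding f_def by (cases "even (lev u)") (auto simp: mod2_eq_if)
  moreover have "f u \<noteq> f w" if uw: "u \<in> hood E v r" "w \<in> hood E v r" "u \<noteq> w" "{u, w} \<in> E" for u w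
  proof
    assume eq: "f u = f w"
    have "lev w \<le> Suc (lev u)" "lev u \<le> Suc (lev w)"
      using lev_Suc uw by (auto simp: insert_commute)
    then consider "lev u = lev w" | "lev w = Suc (lev u)" | "lev u = Suc (lev w)" by linarith
    then show False
    proof cases
      case 1
      then show ?thesis
        using c[of "lev u" u w] lev[OF uw(1)] lev[OF uw(2)] uw eq by (auto simp: f_def split: if_splits)
    qed (use eq in \<open>auto simp: f_def mod_Suc split: if_splits\<close>)
  qed
  ultimately show ?thesis by blast
qed

text \<open>Shortest paths from \<open>v\<close> never use an edge inside a layer.\<close>

lemma hood_delete_layer_edges:
  assumes "\<And>e. e \<in> C \<Longrightarrow> e \<subseteq> layer E v i"
  shows "hood (E - C) v j = hood E v j"
proof
  show "hood E v j \<subseteq> hood (E - C) v j"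
  proof (induction j)
    case (Suc j)
    show ?case
    proof
      fix w assume w: "w \<in> hood E v (Suc j)"
      show "w \<in> hood (E - C) v (Suc j)"
      proof (cases "w \<in> hood E v j")
        case True
        then show ?thesis using Suc.IH by auto
      next
        case False
        then obtain u where u: "u \<in> hood E v j" "{u, w} \<in> E" using w by auto
        have "{u, w} \<notin> C"
        proof
          assume "{u, w} \<in> C"
          then have "u \<in> layer E v i" "w \<in> layer E v i" using assms by auto
          then have "\<not> j < i" "w \<in> hood E v i" using u by (auto simp: layer_def)
          then show False using False hood_mono[of i j E v] by auto
        qed
        then show ?thesis using u Suc.IH by auto
      qed
    qed
  qed simp
qed (simp add: hood_mono_edges)

lemma card_hood_le:
  assumes E: "finite E" and deg: "\<And>u. real (card {e \<in> E. u \<in> e}) \<le> D" 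
  shows "finite (hood E v i) \<and> real (card (hood E v i)) \<le> (1 + D) ^ i"
proof (induction i)
  case (Suc i)
  define N where "N u = {w. {u, w} \<in> E}" for u
  have inj: "inj_on (\<lambda>w. {u, w}) (N u)" for u by (auto simp: inj_on_def doubleton_eq_iff)
  have im: "(\<lambda>w. {u, w}) ` N u \<subseteq> {e \<in> E. u \<in> e}" for u by (auto simp: N_def)
  have finN: "finite (N u)" for u
    using inj_on_finite[OF inj im] E by simp
  have "card (N u) \<le> card {e \<in> E. u \<in> e}" for u
    using card_inj_on_le[OF inj im] E by simp
  then have cardN: "real (card (N u)) \<le> D" for u using deg[of u] by (meson le_trans of_nat_mono order_trans)
  have eq: "hood E v (Suc i) = hood E v i \<union> (\<Union>u\<in>hood E v i. N u)" by (auto simp: N_def)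
  have fin: "finite (hood E v (Suc i))" using Suc finN by (simp only: eq) auto
  have "card (hood E v (Suc i)) \<le> card (hood E v i) + (\<Sum>u\<in>hood E v i. card (N u))"
    unfolding eq using Suc card_Un_le[of "hood E v i" "\<Union> (N ` hood E v i)"] card_UN_le[of "hood E v i" N]
    by linarith
  then have "real (card (hood E v (Suc i))) \<le> real (card (hood E v i)) + (\<Sum>u\<in>hood E v i. real (card (N u)))"
    by (metis of_nat_add of_nat_mono of_nat_sum)
  also have "\<dots> \<le> real (card (hood E v i)) + (\<Sum>u\<in>hood E v i. D)"
    using cardN by (intro add_left_mono sum_mono)
  also have "\<dots> = (1 + D) * real (card (hood E v i))" by (simp add: algebra_simps)
  also have "\<dots> \<le> (1 + D) * (1 + D) ^ i"
    using Suc deg[of v] by (intro mult_left_mono) auto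
  finally show ?case using fin by simp
qed simp


section \<open>Weighted graphs and degrees\<close>

text \<open>The edges of the complete graph on \<open>{..<n}\<close>.\<close>

definition pairs :: "nat \<Rightarrow> nat set set" where
  "pairs n = {e. e \<subseteq> {..<n} \<and> card e = 2}"

lemma finite_pairs [simp]: "finite (pairs n)"
  by (rule finite_subset[of _ "Pow {..<n}"]) (auto simp: pairs_def)

text \<open>If every edge carries the weight \<open>q\<close> and a graph the product of the weights of its edges, then
  the weights of the graphs on \<open>{..<n}\<close> add up to \<open>(1 + q) ^ card (pairs n)\<close>. Divided by this
  total, they are the probabilities of the random graph with edge probability \<open>q / (1 + q)\<close>.\<close>

lemma sum_prod_Pow:
  fixes h :: "'a \<Rightarrow> real"
  assumes "finite P"
  shows "(\<Sum>E\<in>Pow P. \<Prod>e\<in>E. h e) = (\<Prod>e\<in>P. h e + 1)"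
  using prod_add[OF assms, of h "\<lambda>_. 1"] by simp

lemma sum_power_card_Pow:
  fixes q :: real
  assumes "finite P"
  shows "(\<Sum>E\<in>Pow P. q ^ card E) = (1 + q) ^ card P"
  using sum_prod_Pow[OF assms, of "\<lambda>_. q"] by (simp add: add.commute)

lemma card_star_pairs_le: "card {e \<in> pairs n. v \<in> e} \<le> n"
proof -
  have "{e \<in> pairs n. v \<in> e} \<subseteq> (\<lambda>w. {v, w}) ` {..<n}"
    by (auto simp: pairs_def card_2_iff)
  then have "card {e \<in> pairs n. v \<in> e} \<le> card {..<n}" by (meson finite_lessThan surj_card_le)
  then show ?thesis by simp
qed

text \<open>A Chernoff bound: the weight is at most \<open>2 powr (- D)\<close> times the sum over all graphs of
  \<open>q ^ card E * 2 ^ d\<close> with \<open>d\<close> the degree of \<open>v\<close>, and this sum is a product over the edges.\<close>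

lemma weight_large_degree_at:
  fixes q D :: real
  assumes q: "0 \<le> q"
  shows "(\<Sum>E | E \<subseteq> pairs n \<and> D < real (card {e \<in> E. v \<in> e}). q ^ card E)
    \<le> exp (q * n) * 2 powr (- D) * (1 + q) ^ card (pairs n)"
proof -
  let ?P = "pairs n" let ?d = "\<lambda>E. card {e \<in> E. v \<in> e}"
  have *: "(\<Prod>e\<in>E. q * (if v \<in> e then 2 else 1)) = q ^ card E * 2 ^ ?d E" if "E \<subseteq> ?P" for E
    using finite_subset[OF that finite_pairs]
    by (simp add: prod.distrib prod.If_cases Int_def)
  have "(\<Sum>E | E \<subseteq> ?P \<and> D < real (?d E). q ^ card E)
      \<le> (\<Sum>E | E \<subseteq> ?P \<and> D < real (?d E). 2 powr (- D) * (q ^ card E * 2 ^ ?d E))"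
  proof (rule sum_mono)
    fix E assume "E \<in> {E. E \<subseteq> ?P \<and> D < real (?d E)}"
    then have "1 \<le> 2 powr (- D) * 2 powr real (?d E)"
      by (subst powr_add[symmetric]) (auto intro: ge_one_powr_ge_zero)
    then have "q ^ card E * 1 \<le> q ^ card E * (2 powr (- D) * 2 ^ ?d E)"
      using q by (intro mult_left_mono) (auto simp: powr_realpow)
    then show "q ^ card E \<le> 2 powr (- D) * (q ^ card E * 2 ^ ?d E)" by (simp add: mult_ac)
  qed
  also have "\<dots> \<le> (\<Sum>E\<in>Pow ?P. 2 powr (- D) * (q ^ card E * 2 ^ ?d E))"
    using q by (intro sum_mono2) auto
  also have "\<dots> = 2 powr (- D) * (\<Sum>E\<in>Pow ?P. \<Prod>e\<in>E. q * (if v \<in> e then 2 else 1))"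
    by (simp add: sum_distrib_left *)
  also have "\<dots> = 2 powr (- D) * (\<Prod>e\<in>?P. q * (if v \<in> e then 2 else 1) + 1)"
    by (simp add: sum_prod_Pow)
  also have "\<dots> \<le> 2 powr (- D) * (\<Prod>e\<in>?P. (if v \<in> e then 1 + q else 1) * (1 + q))"
    \<comment> \<open>An edge at \<open>v\<close> contributes \<open>1 + 2 * q\<close>, which is at most \<open>(1 + q) * (1 + q)\<close>.\<close>
    using q by (intro mult_left_mono prod_mono) (auto simp: algebra_simps)
  also have "\<dots> = 2 powr (- D) * ((1 + q) ^ card {e \<in> ?P. v \<in> e} * (1 + q) ^ card ?P)"
    by (simp add: prod.distrib prod.If_cases Int_def)
  also have "(1 + q) ^ card {e \<in> ?P. v \<in> e} \<le> (1 + q) ^ n"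
    using q card_star_pairs_le by (intro power_increasing) auto
  also have "(1 + q) ^ n \<le> exp q ^ n"
    using q by (intro power_mono exp_ge_add_one_self) (auto simp: add.commute)
  also have "exp q ^ n = exp (q * n)" by (simp add: exp_of_nat_mult[symmetric] mult.commute)
  finally show ?thesis using q by (simp add: mult_ac)
qed

lemma sum_UN_le:
  fixes f :: "'a \<Rightarrow> real"
  assumes "finite I" "\<And>i. i \<in> I \<Longrightarrow> finite (A i)" "\<And>x. 0 \<le> f x"
  shows "sum f (\<Union>i\<in>I. A i) \<le> (\<Sum>i\<in>I. sum f (A i))"
  using assms(1,2)
proof (induction I rule: finite_induct)
  case (insert i I)
  have "sum f (A i \<union> (\<Union>i\<in>I. A i)) \<le> sum f (A i) + sum f (\<Union>i\<in>I. A i)"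
    using insert assms(3) by (subst sum.union_inter[symmetric]) (auto intro: sum_nonneg)
  then show ?case using insert by simp
qed simp

lemma weight_large_degree:
  fixes q D :: real
  assumes q: "0 \<le> q"
  shows "(\<Sum>E | E \<subseteq> pairs n \<and> (\<exists>v<n. D < real (card {e \<in> E. v \<in> e})). q ^ card E)
    \<le> n * exp (q * n) * 2 powr (- D) * (1 + q) ^ card (pairs n)"
proof -
  let ?A = "\<lambda>v. {E. E \<subseteq> pairs n \<and> D < real (card {e \<in> E. v \<in> e})}"
  have fin: "finite (?A v)" for v by (rule finite_subset[of _ "Pow (pairs n)"]) auto
  have "{E. E \<subseteq> pairs n \<and> (\<exists>v<n. D < real (card {e \<in> E. v \<in> e}))} = (\<Union>v<n. ?A v)" by auto
  then have "(\<Sum>E | E \<subseteq> pairs n \<and> (\<exists>v<n. D < real (card {e \<in> E. v \<in> e})). q ^ card E)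
      \<le> (\<Sum>v<n. \<Sum>E\<in>?A v. q ^ card E)"
    using q fin by (simp add: sum_UN_le[of "{..<n}" ?A])
  also have "\<dots> \<le> (\<Sum>v<n. exp (q * n) * 2 powr (- D) * (1 + q) ^ card (pairs n))"
    by (intro sum_mono weight_large_degree_at q)
  finally show ?thesis by (simp add: mult_ac)
qed


section \<open>Few vertices have a cycle in one of their layers\<close>

text \<open>A vertex is bad if a layer of radius at most \<open>r\<close> around it contains a cycle. Even cycles would do
  no harm, but excluding all cycles is cheap enough.\<close>

definition bad :: "nat \<Rightarrow> 'a set set \<Rightarrow> 'a \<Rightarrow> bool" where
  "bad r E v \<longleftrightarrow> (\<exists>i\<le>r. \<exists>xs. cycle_in E (layer E v i) xs)"

lemma sum_geometric_from_3:
  fixes x :: real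
  assumes "0 \<le> x" "x < 1"
  shows "(\<Sum>k=3..n. x ^ k) \<le> x ^ 3 / (1 - x)"
proof -
  have "(\<Sum>k=3..n. x ^ k) \<le> (\<Sum>k\<in>{..<n} . x ^ (k + 3))"
  proof (cases "n < 3")
    case False
    have "(\<Sum>k=3..n. x ^ k) = (\<Sum>k=0..n-3. x ^ (k + 3))"
      using sum.shift_bounds_cl_nat_ivl[of "\<lambda>k. x ^ k" 0 3 "n-3"] False by simp
    also have "\<dots> \<le> (\<Sum>k\<in>{..<n}. x ^ (k + 3))"
      using assms False by (intro sum_mono2) auto
    finally show ?thesis .
  qed (use assms in \<open>auto intro: sum_nonneg\<close>)
  also have "\<dots> = x ^ 3 * (\<Sum>k<n. x ^ k)" by (simp add: power_add sum_distrib_right mult.commute)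
  also have "\<dots> = x ^ 3 * ((1 - x ^ n) / (1 - x))" using assms by (simp add: sum_gp_strict)
  also have "\<dots> \<le> x ^ 3 * (1 / (1 - x))"
    using assms by (intro mult_left_mono divide_right_mono) auto
  finally show ?thesis by simp
qed

text \<open>Graphs in which \<open>v\<close> is bad are mapped injectively to pairs of a graph \<open>F\<close> and a cycle \<open>xs\<close>
  within \<open>hood F v r\<close>: choose a cycle \<open>xs\<close> inside a layer and delete its edges. The
  original weight is \<open>q ^ length xs\<close> times that of \<open>F\<close>, and the ball around \<open>v\<close> is unchanged. As the ball of \<open>F\<close> has at most
  \<open>(1 + D) ^ r\<close> elements, there are at most \<open>(1 + D) ^ (r * k)\<close> lists \<open>xs\<close> of length \<open>k\<close> for a given \<open>F\<close>,
  and a geometric series remains.\<close>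

lemma weight_bad:
  fixes q D x :: real and n :: nat
  assumes q: "0 \<le> q" and D: "0 \<le> D" and x: "q * (1 + D) ^ r \<le> x" "x < 1"
  defines "\<G> \<equiv> {E. E \<subseteq> pairs n \<and> (\<forall>u. real (card {e \<in> E. u \<in> e}) \<le> D)}"
  shows "(\<Sum>E | E \<in> \<G> \<and> bad r E v. q ^ card E) \<le> x ^ 3 / (1 - x) * (1 + q) ^ card (pairs n)"
proof -
  let ?P = "pairs n"
  let ?B = "{E. E \<in> \<G> \<and> bad r E v}"
  define Xs where "Xs E = {xs. set xs \<subseteq> hood E v r \<and> 3 \<le> length xs \<and> length xs \<le> n}" for E
  have fin\<G>: "finite \<G>" by (rule finite_subset[of _ "Pow ?P"]) (auto simp: \<G>_def)
  have hood: "finite (hood E v r) \<and> real (card (hood E v r)) \<le> (1 + D) ^ r" if "E \<in> \<G>" for E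
    using that finite_subset[OF _ finite_pairs] by (intro card_hood_le) (auto simp: \<G>_def)
  have Xs_eq: "Xs E = (\<Union>k\<in>{3..n}. {xs. set xs \<subseteq> hood E v r \<and> length xs = k})" for E
    by (auto simp: Xs_def)
  have finXs: "finite (Xs E)" if "E \<in> \<G>" for E
    unfolding Xs_eq using hood[OF that] by (auto intro: finite_lists_length_eq)
  have x0: "0 \<le> x" by (rule order_trans[OF _ x(1)]) (use q D in auto)
  have sumXs: "(\<Sum>xs\<in>Xs E. q ^ length xs) \<le> x ^ 3 / (1 - x)" if E: "E \<in> \<G>" for E
  proof -
    let ?L = "\<lambda>k. {xs. set xs \<subseteq> hood E v r \<and> length xs = k}"
    have "(\<Sum>xs\<in>Xs E. q ^ length xs) = (\<Sum>k=3..n. \<Sum>xs\<in>?L k. q ^ length xs)"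
      unfolding Xs_eq using hood[OF E] by (subst sum.UNION_disjoint) (auto intro: finite_lists_length_eq)
    also have "\<dots> = (\<Sum>k=3..n. (q * real (card (hood E v r))) ^ k)"
      using hood[OF E] by (intro sum.cong) (auto simp: card_lists_length_eq power_mult_distrib)
    also have "\<dots> \<le> (\<Sum>k=3..n. x ^ k)"
      using hood[OF E] q by (intro sum_mono power_mono order_trans[OF mult_left_mono x(1)]) auto
    also have "\<dots> \<le> x ^ 3 / (1 - x)" using x0 x by (intro sum_geometric_from_3) auto
    finally show ?thesis .
  qed
  have "\<forall>E\<in>?B. \<exists>xs. \<exists>i\<le>r. cycle_in E (layer E v i) xs" by (auto simp: bad_def)
  from bchoice[OF this] obtain cyc where
    cyc: "\<And>E. E \<in> ?B \<Longrightarrow> \<exists>i\<le>r. cycle_in E (layer E v i) (cyc E)" by blast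
  define \<phi> where "\<phi> E = (E - cycle_edges (cyc E), cyc E)" for E
  have cyc_sub: "cycle_edges (cyc E) \<subseteq> E" "distinct (cyc E)" "3 \<le> length (cyc E)" if "E \<in> ?B" for E
    using cyc[OF that] by (auto simp: cycle_in_def)
  have inj: "inj_on \<phi> ?B"
  proof (rule inj_onI)
    fix E F assume EF: "E \<in> ?B" "F \<in> ?B" "\<phi> E = \<phi> F"
    then have "(E - cycle_edges (cyc E)) \<union> cycle_edges (cyc E) = (F - cycle_edges (cyc F)) \<union> cycle_edges (cyc F)"
      unfolding \<phi>_def prod.inject by metis
    then show "E = F" using cyc_sub(1)[OF EF(1)] cyc_sub(1)[OF EF(2)] by blast
  qed
  have weight: "q ^ card E = (case \<phi> E of (F, xs) \<Rightarrow> q ^ card F * q ^ length xs)" if "E \<in> ?B" for E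
  proof -
    have "finite E" using that finite_subset[OF _ finite_pairs] by (auto simp: \<G>_def)
    then have "card (E - cycle_edges (cyc E)) + card (cycle_edges (cyc E)) = card E"
      using cyc_sub(1)[OF that] by (metis card_mono card_Diff_subset finite_subset le_add_diff_inverse2)
    then show ?thesis
      using card_cycle_edges[OF cyc_sub(2,3)[OF that]] by (simp add: \<phi>_def power_add[symmetric])
  qed
  have sub: "\<phi> ` ?B \<subseteq> (SIGMA E:\<G>. Xs E)"
  proof (rule image_subsetI)
    fix E assume E: "E \<in> ?B"
    let ?F = "E - cycle_edges (cyc E)"
    have finE: "finite E" "E \<subseteq> ?P" using E finite_subset[OF _ finite_pairs] by (auto simp: \<G>_def)
    have "real (card {e \<in> ?F. u \<in> e}) \<le> D" for u
    proof -
      have "card {e \<in> ?F. u \<in> e} \<le> card {e \<in> E. u \<in> e}" using finE by (intro card_mono) auto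
      moreover have "real (card {e \<in> E. u \<in> e}) \<le> D" using E by (auto simp: \<G>_def)
      ultimately show ?thesis by linarith
    qed
    then have F: "?F \<in> \<G>" using finE by (auto simp: \<G>_def)
    obtain i where i: "i \<le> r" "cycle_in E (layer E v i) (cyc E)" using cyc[OF E] by blast
    have "e \<subseteq> layer E v i" if "e \<in> cycle_edges (cyc E)" for e
      using cycle_edges_subset[OF that] i by (auto simp: cycle_in_def)
    then have "hood ?F v r = hood E v r" by (rule hood_delete_layer_edges)
    then have "set (cyc E) \<subseteq> hood ?F v r"
      using i layer_subset_hood[OF i(1), of E v] by (auto simp: cycle_in_def)
    moreover have "length (cyc E) \<le> n"
    proof -
      have "set (cyc E) \<subseteq> \<Union> (cycle_edges (cyc E))"
        by (auto simp: cycle_edges_def in_set_conv_nth)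
      also have "\<dots> \<subseteq> {..<n}" using cyc_sub(1)[OF E] finE by (auto simp: pairs_def)
      finally have "card (set (cyc E)) \<le> card {..<n}" by (intro card_mono) auto
      then show ?thesis using distinct_card[OF cyc_sub(2)[OF E]] by simp
    qed
    ultimately show "\<phi> E \<in> (SIGMA E:\<G>. Xs E)"
      using F cyc_sub(3)[OF E] by (simp add: \<phi>_def Xs_def)
  qed
  have "(\<Sum>E\<in>?B. q ^ card E) = (\<Sum>(F, xs)\<in>\<phi> ` ?B. q ^ card F * q ^ length xs)"
    using weight by (subst sum.reindex[OF inj]) (auto intro!: sum.cong)
  also have "\<dots> \<le> (\<Sum>(F, xs)\<in>(SIGMA E:\<G>. Xs E). q ^ card F * q ^ length xs)"
    using sub q fin\<G> finXs by (intro sum_mono2) auto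
  also have "\<dots> = (\<Sum>F\<in>\<G>. q ^ card F * (\<Sum>xs\<in>Xs F. q ^ length xs))"
    using fin\<G> finXs by (subst sum.Sigma[symmetric]) (auto simp: sum_distrib_left)
  also have "\<dots> \<le> (\<Sum>F\<in>\<G>. q ^ card F * (x ^ 3 / (1 - x)))"
    using q sumXs by (intro sum_mono mult_left_mono) auto
  also have "\<dots> \<le> (\<Sum>F\<in>Pow ?P. q ^ card F * (x ^ 3 / (1 - x)))"
    using q x0 x by (intro sum_mono2) (auto simp: \<G>_def)
  also have "\<dots> = x ^ 3 / (1 - x) * (1 + q) ^ card ?P"
    by (subst sum_distrib_right[symmetric]) (simp add: sum_power_card_Pow)
  finally show ?thesis .
qed

text \<open>Markov's inequality for the number of bad vertices.\<close>

lemma weight_many_bad: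
  fixes q D x :: real and n :: nat
  assumes q: "0 \<le> q" and D: "0 \<le> D" and x: "q * (1 + D) ^ r \<le> x" "x < 1"
  defines "\<G> \<equiv> {E. E \<subseteq> pairs n \<and> (\<forall>u. real (card {e \<in> E. u \<in> e}) \<le> D)}"
  shows "(\<Sum>E | E \<in> \<G> \<and> n < 6 * card {v. v < n \<and> bad r E v}. q ^ card E)
    \<le> 6 * (x ^ 3 / (1 - x)) * (1 + q) ^ card (pairs n)"
proof (cases "n = 0")
  case False
  have fin: "finite \<G>" by (rule finite_subset[of _ "Pow (pairs n)"]) (auto simp: \<G>_def)
  let ?b = "\<lambda>E. card {v. v < n \<and> bad r E v}"
  let ?A = "{E. E \<in> \<G> \<and> n < 6 * ?b E}"
  have "n * (\<Sum>E\<in>?A. q ^ card E) = (\<Sum>E\<in>?A. q ^ card E * real n)"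
    by (simp add: sum_distrib_left mult.commute)
  also have "\<dots> \<le> (\<Sum>E\<in>?A. q ^ card E * (6 * real (?b E)))"
    using q by (intro sum_mono mult_left_mono) (auto simp: of_nat_less_iff[symmetric] simp del: of_nat_less_iff)
  also have "\<dots> \<le> (\<Sum>E\<in>\<G>. q ^ card E * (6 * real (?b E)))"
    using q fin by (intro sum_mono2) auto
  also have "\<dots> = (\<Sum>E\<in>\<G>. \<Sum>v<n. 6 * (if bad r E v then q ^ card E else 0))"
    by (intro sum.cong refl) (simp add: sum_distrib_left[symmetric] sum.If_cases Int_def mult_ac)
  also have "\<dots> = 6 * (\<Sum>v<n. \<Sum>E\<in>\<G>. if bad r E v then q ^ card E else 0)"
    by (subst sum.swap) (simp add: sum_distrib_left)
  also have "\<dots> = 6 * (\<Sum>v<n. \<Sum>E | E \<in> \<G> \<and> bad r E v. q ^ card E)"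
    using fin by (simp add: sum.If_cases Int_def)
  also have "\<dots> \<le> 6 * (\<Sum>v<n. x ^ 3 / (1 - x) * (1 + q) ^ card (pairs n))"
    unfolding \<G>_def by (intro mult_left_mono sum_mono weight_bad q D x) auto
  also have "\<dots> = n * (6 * (x ^ 3 / (1 - x)) * (1 + q) ^ card (pairs n))" by simp
  finally show ?thesis using False by (simp only: mult_le_cancel_left_pos of_nat_0_less_iff neq0_conv)
next
  case True
  have "0 \<le> x" by (rule order_trans[OF _ x(1)]) (use q D in auto)
  then show ?thesis using True q x(2) by simp
qed


section \<open>Colourings of most of the vertices\<close>

text \<open>Below, \<open>g\<close> assigns to each vertex one of the colours \<open>0, \<dots>, l - 1\<close>, or \<open>l\<close> to mark it as uncoloured.
  Only pairs of vertices of the same proper colour count as monochromatic.\<close>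

definition monochromatic :: "nat \<Rightarrow> nat \<Rightarrow> (nat \<Rightarrow> nat) \<Rightarrow> nat set set" where
  "monochromatic n l g = {e \<in> pairs n. \<exists>c<l. g ` e = {c}}"

lemma real_choose_two: "real (k choose 2) = (real k ^ 2 - real k) / 2"
  by (induction k) (auto simp: numeral_2_eq_2 field_simps)

text \<open>At least \<open>5 * n / 6\<close> vertices are coloured, so the colour classes have an average size of at least
  \<open>t = 5 * n / (6 * l)\<close>. Each class size \<open>k\<close> satisfies \<open>k ^ 2 \<ge> 2 * t * k - t ^ 2\<close>; summing this over the classes
  gives the bound.\<close>

lemma card_monochromatic_ge:
  assumes l: "0 < l" and few: "6 * card {v. v < n \<and> \<not> g v < l} \<le> n"
  shows "(25 * real n ^ 2 / (36 * real l) - real n) / 2 \<le> real (card (monochromatic n l g))"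
proof -
  define K where "K c = {v. v < n \<and> g v = c}" for c
  define t where "t = 5 * real n / (6 * real l)"
  have finK [simp]: "finite (K c)" for c by (simp add: K_def)
  have eq: "monochromatic n l g = (\<Union>c<l. {e. e \<subseteq> K c \<and> card e = 2})"
  proof (intro set_eqI iffI)
    fix e assume "e \<in> monochromatic n l g"
    then show "e \<in> (\<Union>c<l. {e. e \<subseteq> K c \<and> card e = 2})"
      by (auto simp: monochromatic_def pairs_def K_def)
  next
    fix e assume "e \<in> (\<Union>c<l. {e. e \<subseteq> K c \<and> card e = 2})"
    then obtain c where c: "c < l" "e \<subseteq> K c" "card e = 2" by blast
    then have "e \<noteq> {}" by auto
    then have "g ` e = {c}" using c by (auto simp: K_def)
    then show "e \<in> monochromatic n l g" using c by (auto simp: monochromatic_def pairs_def K_def)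
  qed
  have disj: "{e. e \<subseteq> K c \<and> card e = 2} \<inter> {e. e \<subseteq> K d \<and> card e = 2} = {}" if "c \<noteq> d" for c d
  proof -
    have K: "K c \<inter> K d = {}" using that by (auto simp: K_def)
    have "card e \<noteq> 2" if "e \<subseteq> K c" "e \<subseteq> K d" for e
    proof -
      have "e \<subseteq> K c \<inter> K d" using that by (rule Int_greatest)
      then have "e = {}" unfolding K by (rule subset_empty[THEN iffD1])
      then show ?thesis by simp
    qed
    then show ?thesis by blast
  qed
  have fin2: "finite {e. e \<subseteq> K c \<and> card e = 2}" for c
    by (rule finite_subset[of _ "Pow (K c)"]) auto
  have "card (monochromatic n l g) = (\<Sum>c<l. card (K c) choose 2)"
    unfolding eq using disj fin2 by (subst card_UN_disjoint) (auto simp: n_subsets)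
  then have card: "real (card (monochromatic n l g)) = (\<Sum>c<l. (real (card (K c)) ^ 2 - real (card (K c))) / 2)"
    by (simp add: real_choose_two)
  have "(\<Sum>c<l. card (K c)) = card (\<Union>c<l. K c)"
    by (subst card_UN_disjoint) (auto simp: K_def)
  also have "(\<Union>c<l. K c) = {v. v < n \<and> g v < l}" by (auto simp: K_def)
  finally have N: "(\<Sum>c<l. real (card (K c))) = real (card {v. v < n \<and> g v < l})"
    by (metis of_nat_sum)
  have "{..<n} = {v. v < n \<and> g v < l} \<union> {v. v < n \<and> \<not> g v < l}" by auto
  then have "card {v. v < n \<and> g v < l} + card {v. v < n \<and> \<not> g v < l} = card {..<n}"
    by (simp only:) (rule card_Un_disjoint[symmetric], auto)
  then have N_ge: "5 * real n / 6 \<le> (\<Sum>c<l. real (card (K c)))" and N_le: "(\<Sum>c<l. real (card (K c))) \<le> real n"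
    using few unfolding N by auto
  have t0: "0 \<le> t" by (simp add: t_def)
  have tl: "t * real l = 5 * real n / 6" using l by (simp add: t_def)
  have "(25 * real n ^ 2 / (36 * real l) - real n) / 2 = (2 * t * (5 * real n / 6) - real l * t ^ 2 - real n) / 2"
    using l by (simp add: t_def field_simps power2_eq_square)
  also have "\<dots> \<le> (2 * t * (\<Sum>c<l. real (card (K c))) - real l * t ^ 2 - (\<Sum>c<l. real (card (K c)))) / 2"
    using mult_left_mono[OF N_ge, of "2 * t"] t0 N_le by (intro divide_right_mono diff_mono) auto
  also have "\<dots> = (\<Sum>c<l. (2 * t * real (card (K c)) - t ^ 2 - real (card (K c))) / 2)"
    by (simp add: sum_subtractf sum_divide_distrib[symmetric] sum_distrib_left)
  also have "\<dots> \<le> (\<Sum>c<l. (real (card (K c)) ^ 2 - real (card (K c))) / 2)"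
  proof (intro sum_mono divide_right_mono)
    fix c
    show "2 * t * real (card (K c)) - t\<^sup>2 - real (card (K c)) \<le> (real (card (K c)))\<^sup>2 - real (card (K c))"
      using zero_le_power2[of "real (card (K c)) - t"] by (simp add: power2_diff mult_ac)
  qed simp
  finally show ?thesis by (simp add: card)
qed

text \<open>Colourings that leave at most one sixth of the vertices uncoloured. Extensionality of \<open>g\<close> outside
  \<open>{..<n}\<close> makes them finitely many.\<close>

definition almost_coloring :: "nat \<Rightarrow> nat \<Rightarrow> (nat \<Rightarrow> nat) \<Rightarrow> bool" where
  "almost_coloring n l g \<longleftrightarrow>
     g \<in> {..<n} \<rightarrow>\<^sub>E {..l} \<and> 6 * card {v. v < n \<and> \<not> g v < l} \<le> n"

text \<open>Union bound over the almost colourings \<open>g\<close>: the edges of a graph that \<open>g\<close> colours properly avoid all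
  the monochromatic pairs.\<close>

lemma weight_almost_colorable:
  fixes q :: real
  assumes q: "0 \<le> q" and l: "0 < l"
  shows "(\<Sum>E | E \<subseteq> pairs n \<and> (\<exists>g. almost_coloring n l g \<and> E \<inter> monochromatic n l g = {}). q ^ card E)
    \<le> (real l + 1) ^ n * (1 + q) powr (- ((25 * real n ^ 2 / (36 * real l) - real n) / 2))
        * (1 + q) ^ card (pairs n)"
proof -
  let ?P = "pairs n" let ?M = "monochromatic n l"
  define G where "G = {g. almost_coloring n l g}"
  define m where "m = (25 * real n ^ 2 / (36 * real l) - real n) / 2"
  have sub: "G \<subseteq> {..<n} \<rightarrow>\<^sub>E {..l}" by (auto simp: G_def almost_coloring_def)
  have finG: "finite G" by (rule finite_subset[OF sub]) (auto intro: finite_PiE)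
  have "card G \<le> card ({..<n} \<rightarrow>\<^sub>E {..l})" by (intro card_mono sub finite_PiE) auto
  then have "real (card G) \<le> real ((l + 1) ^ n)" unfolding of_nat_le_iff by (simp add: card_funcsetE)
  then have cardG: "real (card G) \<le> (real l + 1) ^ n" by (simp add: add.commute)
  have one: "(\<Sum>E\<in>Pow (?P - ?M g). q ^ card E) \<le> (1 + q) powr (- m) * (1 + q) ^ card ?P" if g: "g \<in> G" for g
  proof -
    have M: "?M g \<subseteq> ?P" by (auto simp: monochromatic_def)
    have "(\<Sum>E\<in>Pow (?P - ?M g). q ^ card E) = (1 + q) ^ card (?P - ?M g)"
      by (simp add: sum_power_card_Pow)
    also have "\<dots> = (1 + q) powr (real (card ?P) - real (card (?M g)))"
      using q M finite_subset[OF M] by (simp add: powr_realpow[symmetric] card_Diff_subset card_mono of_nat_diff)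
    also have "\<dots> \<le> (1 + q) powr (real (card ?P) - m)"
      using q g card_monochromatic_ge[OF l, of n g]
      by (intro powr_mono) (auto simp: m_def G_def almost_coloring_def)
    also have "\<dots> = (1 + q) powr (- m) * (1 + q) powr real (card ?P)"
      by (simp add: powr_add[symmetric])
    also have "(1 + q) powr real (card ?P) = (1 + q) ^ card ?P" using q by (simp add: powr_realpow)
    finally show ?thesis .
  qed
  have "{E. E \<subseteq> ?P \<and> (\<exists>g. almost_coloring n l g \<and> E \<inter> ?M g = {})} = (\<Union>g\<in>G. Pow (?P - ?M g))"
    by (auto simp: G_def)
  then have "(\<Sum>E | E \<subseteq> ?P \<and> (\<exists>g. almost_coloring n l g \<and> E \<inter> ?M g = {}). q ^ card E)
      \<le> (\<Sum>g\<in>G. \<Sum>E\<in>Pow (?P - ?M g). q ^ card E)"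
    using q finG by (simp add: sum_UN_le)
  also have "\<dots> \<le> (\<Sum>g\<in>G. (1 + q) powr (- m) * (1 + q) ^ card ?P)" by (intro sum_mono one)
  also have "\<dots> = real (card G) * ((1 + q) powr (- m) * (1 + q) ^ card ?P)" by simp
  also have "\<dots> \<le> (real l + 1) ^ n * ((1 + q) powr (- m) * (1 + q) ^ card ?P)"
    using q by (intro mult_right_mono cardG) auto
  finally show ?thesis by (simp add: m_def mult_ac)
qed


section \<open>From edge sets to graphs with locally small chromatic number\<close>

lemma awalk_in_hood:
  assumes "wf_digraph (with_proj G)" and arcs: "\<And>u w. (u, w) \<in> parcs G \<Longrightarrow> {u, w} \<in> F"
  shows "pre_digraph.awalk (with_proj G) u p w \<Longrightarrow> u \<in> hood F v i \<Longrightarrow> w \<in> hood F v (i + length p)"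
proof (induction p arbitrary: u i)
  case Nil
  then show ?case by (simp add: wf_digraph.awalk_Nil_iff[OF assms(1)])
next
  case (Cons e p)
  interpret wf_digraph "with_proj G" by fact
  obtain a b where e: "e = (a, b)" by (cases e)
  from Cons.prems have ab: "(a, b) \<in> parcs G" "u = a" "awalk b p w"
    by (auto simp: awalk_Cons_iff e)
  then have "b \<in> hood F v (Suc i)" using Cons.prems arcs[OF ab(1)] by auto
  from Cons.IH[OF ab(3) this] show ?case by (simp only: length_Cons add_Suc_right add_Suc)
qed

lemma graph_dist_le_imp_in_hood:
  assumes wf: "wf_digraph (with_proj G)" and arcs: "\<And>u w. (u, w) \<in> parcs G \<Longrightarrow> {u, w} \<in> F"
    and dist: "graph_dist (with_proj G) v u \<le> ereal (real r)"
  shows "u \<in> hood F v r"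
proof -
  interpret wf_digraph "with_proj G" by fact
  have "(INF p\<in>{p. awalk v p u}. ereal (awalk_cost (\<lambda>_. 1) p)) < ereal (real r + 1)"
    using dist by (simp add: graph_dist_def \<mu>_def le_less_trans)
  then obtain p where p: "awalk v p u" "awalk_cost (\<lambda>_. 1) p < real r + 1"
    by (auto simp: INF_less_iff)
  have "awalk_cost (\<lambda>_. 1) p = real (length p)" by (induction p) auto
  then have "length p \<le> r" using p(2) by simp
  then show ?thesis
    using awalk_in_hood[OF wf arcs p(1), of v 0] hood_mono[of "length p" r F v] by auto
qed

text \<open>The witness keeps the edges of \<open>E\<close> between vertices that are not bad, and has isolated vertices for the rest.
  The balls of the remaining vertices are coloured with the layers of \<open>E\<close>, not with their own
  layers; this is possible because deleting edges only shrinks balls. A colouring of the witness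
  becomes an almost colouring of \<open>E\<close> by uncolouring the bad vertices.\<close>

lemma not_local_forces_colorable:
  assumes E: "E \<subseteq> pairs n" and nm: "n \<le> m" and m: "0 < m"
    and few: "6 * card {v. v < n \<and> bad r E v} \<le> n"
    and hit: "\<And>g. almost_coloring n l g \<Longrightarrow> E \<inter> monochromatic n l g \<noteq> {}"
  shows "\<not> local_forces_colorable 4 l r m"
proof
  assume forces: "local_forces_colorable 4 l r m"
  define F where "F = {e \<in> E. \<forall>v\<in>e. \<not> bad r E v}"
  define G where "G = \<lparr>pverts = {..<m}, parcs = {(u, w). {u, w} \<in> F}\<rparr>"
  have F: "u < m \<and> w < m \<and> u \<noteq> w" if "{u, w} \<in> F" for u w
  proof -
    have "{u, w} \<in> pairs n" using that E by (auto simp: F_def)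
    then show ?thesis using nm by (auto simp: pairs_def card_2_iff doubleton_eq_iff)
  qed
  have "pair_graph G"
  proof
    have "parcs G \<subseteq> {..<m} \<times> {..<m}" using F by (auto simp: G_def)
    then show "finite (parcs G)" by (rule finite_subset) simp
    show "symmetric (with_proj G)"
      by (auto simp: symmetric_def sym_def G_def insert_commute)
  qed (use F in \<open>auto simp: G_def\<close>)
  then interpret pair_graph G .
  have wf: "wf_digraph (with_proj G)" by unfold_locales
  have arcs: "(u, w) \<in> parcs G \<longleftrightarrow> {u, w} \<in> F" for u w by (simp add: G_def)
  have ball: "colorable (graph_ball r v (with_proj G)) 4" for v
  proof -
    have "\<exists>f :: nat \<Rightarrow> nat. (\<forall>u. f u < 4) \<and>
      (\<forall>u\<in>hood F v r. \<forall>w\<in>hood F v r. {u, w} \<in> F \<longrightarrow> f u \<noteq> f w)"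
    proof (cases "bad r E v")
      case True
      have "hood F v i = {v}" for i
        using True by (induction i) (auto simp: F_def)
      then show ?thesis using F[of v v] by (intro exI[of _ "\<lambda>_. 0"]) auto
    next
      case False
      have "hood E v i \<subseteq> insert v {..<n}" for i
      proof (induction i)
        case (Suc i)
        have "w < n" if "{u, w} \<in> E" for u w using that E by (auto simp: pairs_def)
        then show ?case using Suc by auto
      qed simp
      then have "finite (hood E v r)" by (rule finite_subset) simp
      moreover have "\<not> cycle_in E (layer E v i) xs" if "i \<le> r" for i xs
        using False that by (auto simp: bad_def)
      ultimately obtain f :: "nat \<Rightarrow> nat" where f: "\<And>u. f u < 4"
        "\<And>u w. u \<in> hood E v r \<Longrightarrow> w \<in> hood E v r \<Longrightarrow> u \<noteq> w \<Longrightarrow> {u, w} \<in> E \<Longrightarrow> f u \<noteq> f w"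
        using hood_4_colorable[of E v r] by blast
      have "F \<subseteq> E" by (auto simp: F_def)
      then show ?thesis using f F hood_mono_edges[of F E v r] by (intro exI[of _ f]) blast
    qed
    then obtain f :: "nat \<Rightarrow> nat" where f: "\<And>u. f u < 4"
      "\<And>u w. u \<in> hood F v r \<Longrightarrow> w \<in> hood F v r \<Longrightarrow> {u, w} \<in> F \<Longrightarrow> f u \<noteq> f w" by blast
    have "proper_coloring (graph_ball r v (with_proj G)) 4 f"
      using f graph_dist_le_imp_in_hood[OF wf, of F v _ r]
      by (auto simp: proper_coloring_def graph_ball_def arcs)
    then show ?thesis by (auto simp: colorable_def)
  qed
  have "local_chromatic_number r (with_proj G) \<le> 4"
    unfolding local_chromatic_number_def
    using m ball by (subst Max_le_iff) (auto simp: G_def chromatic_number_def intro!: Least_le)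
  then have "colorable (with_proj G) l"
    using forces \<open>pair_graph G\<close> by (auto simp: local_forces_colorable_def G_def)
  then obtain f where "proper_coloring (with_proj G) l f" by (auto simp: colorable_def)
  then have f: "\<And>v. v < m \<Longrightarrow> f v < l" "\<And>u w. {u, w} \<in> F \<Longrightarrow> f u \<noteq> f w"
    by (auto simp: proper_coloring_def G_def)
  define g where "g = restrict (\<lambda>v. if bad r E v then l else f v) {..<n}"
  have "{v. v < n \<and> \<not> g v < l} = {v. v < n \<and> bad r E v}"
    using f(1) nm by (auto simp: g_def)
  then have "almost_coloring n l g"
    using f(1) nm few by (auto simp: almost_coloring_def g_def intro: less_imp_le)
  then obtain e where e: "e \<in> E" "e \<in> monochromatic n l g" using hit by blast
  then obtain c where c: "c < l" "g ` e = {c}" "e \<subseteq> {..<n}" "card e = 2"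
    by (auto simp: monochromatic_def pairs_def)
  then obtain u w where uw: "e = {u, w}" "u \<noteq> w" by (auto simp: card_2_iff)
  have "g u = c" "g w = c" "u < n" "w < n" using c uw by auto
  then have "f u = f w" "e \<in> F" using c(1) e(1) uw by (auto simp: g_def F_def split: if_splits)
  then show False using f(2) uw by blast
qed

lemma f_loc_less:
  assumes "\<And>m. n \<le> m \<Longrightarrow> \<not> local_forces_colorable c l r m"
  shows "f_loc c l r < enat n"
proof -
  let ?P = "local_forces_colorable c l r"
  have less: "m < n" if "?P m" for m using assms[of m] that by (meson not_le)
  have "?P 0"
    unfolding local_forces_colorable_def
  proof (intro allI impI)
    fix G :: "nat pair_pre_digraph"
    assume G: "pair_graph G" "card (pverts G) = 0"
    interpret pair_graph G by fact
    have "pverts G = {}" using G(2) pair_finite_verts by simp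
    moreover from this have "parcs G = {}" using in_arcsD1 by fastforce
    ultimately show "colorable (with_proj G) l" by (simp add: colorable_def proper_coloring_def)
  qed
  then have "?P (GREATEST m. ?P m)" by (rule GreatestI_nat[where b = n]) (rule less_imp_le[OF less])
  then have "(GREATEST m. ?P m) < n" by (rule less)
  moreover have "bdd_above {m. ?P m}" by (rule bdd_aboveI[of _ n]) (auto dest: less)
  ultimately show ?thesis by (simp add: f_loc_def)
qed


section \<open>Choice of the parameters\<close>

lemma eventually_parameter_bounds:
  fixes r :: nat
  shows "\<forall>\<^sub>F l in sequentially. 2 \<le> real l * ln (real l) \<and>
    (10 * (real l * ln (real l))) ^ (r + 1) * exp (- (real l * ln (real l))) \<le> 1 / 10 \<and>
    ln (real l + 1) + 10 \<le> (25 / 24 * ln (real l) - 1 / 100) / (51 / 50)"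
proof (intro eventually_conj)
  have L: "filterlim (\<lambda>l::nat. real l * ln (real l)) at_top sequentially" by real_asymp
  show "\<forall>\<^sub>F l::nat in sequentially. 2 \<le> real l * ln (real l)"
    using L by (simp add: filterlim_at_top)
  have "((\<lambda>x. 10 ^ (r + 1) * (x ^ (r + 1) / exp x)) \<longlongrightarrow> 10 ^ (r + 1) * (0::real)) at_top"
    by (intro tendsto_intros tendsto_power_div_exp_0)
  then have "((\<lambda>x. (10 * x) ^ (r + 1) * exp (- x)) \<longlongrightarrow> (0::real)) at_top"
    by (simp add: power_mult_distrib exp_minus field_simps)
  from filterlim_compose[OF this L]
  have "\<forall>\<^sub>F l::nat in sequentially. (10 * (real l * ln (real l))) ^ (r + 1) * exp (- (real l * ln (real l))) < 1 / 10"
    by (rule order_tendstoD) simp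
  then show "\<forall>\<^sub>F l::nat in sequentially. (10 * (real l * ln (real l))) ^ (r + 1) * exp (- (real l * ln (real l))) \<le> 1 / 10"
    by eventually_elim simp
  show "\<forall>\<^sub>F l::nat in sequentially. ln (real l + 1) + 10 \<le> (25 / 24 * ln (real l) - 1 / 100) / (51 / 50)"
    by real_asymp
qed

text \<open>The edge weight \<open>q = 3 * L / n\<close> makes the average degree about \<open>3 * L\<close>. Half of this has to exceed
  \<open>l * ln l\<close> by a factor of \<open>(6 / 5) ^ 2\<close>, because colourings of five sixths of the vertices are
  to be excluded. The degree bound \<open>D = 6 * L\<close> is twice the average. The base \<open>10 * L\<close> in the size of \<open>n\<close> keeps
  \<open>q * (1 + D) ^ r\<close>, which bounds the average degree inside a ball, below \<open>3 / 10\<close>. The three kinds of graphs to be avoided then have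
  relative weight at most \<open>1 / 10\<close>, \<open>6 * (3 / 10) ^ 3 / (7 / 10) < 1 / 4\<close> and \<open>1 / 10\<close>.\<close>

lemma ex_good_edge_set:
  fixes l n r :: nat and L X :: real
  defines "L \<equiv> real l * ln (real l)"
  defines "X \<equiv> (10 * L) ^ (r + 1)"
  assumes r: "0 < r" and L: "2 \<le> L"
    and A: "X * exp (- L) \<le> 1 / 10"
    and C: "ln (real l + 1) + 10 \<le> (25 / 24 * ln (real l) - 1 / 100) / (51 / 50)"
    and n: "real n \<le> X" "X - 1 \<le> real n"
  shows "\<exists>E. E \<subseteq> pairs n \<and> 6 * card {v. v < n \<and> bad r E v} \<le> n \<and>
    (\<forall>g. almost_coloring n l g \<longrightarrow> E \<inter> monochromatic n l g \<noteq> {})"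
proof (rule ccontr)
  assume none: "\<not> ?thesis"
  define q where "q = 3 * L / real n"
  define D where "D = 6 * L"
  let ?Z = "(1 + q) ^ card (pairs n)"
  have l: "0 < l" using L by (cases l) (auto simp: L_def)
  have "(10 * L) ^ 2 \<le> X" unfolding X_def using r L by (intro power_increasing) auto
  moreover have "2 * L \<le> L ^ 2" using L by (simp add: power2_eq_square)
  ultimately have XL: "200 * L \<le> X" by (simp add: power_mult_distrib)
  have n0: "0 < real n" using n XL L by linarith
  have qn: "q * real n = 3 * L" using n0 by (simp add: q_def)
  have "50 * (3 * L) \<le> real n" using n XL L by linarith
  then have q: "0 \<le> q" "q \<le> 1 / 50" using n0 L by (simp_all add: q_def pos_divide_le_eq)

  have degrees: "(\<Sum>E | E \<subseteq> pairs n \<and> (\<exists>v<n. D < real (card {e \<in> E. v \<in> e})). q ^ card E) \<le> 1 / 10 * ?Z"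
  proof -
    have "ln 2 \<ge> (2/3 :: real)" by (rule ln2_ge_two_thirds)
    then have "3 * L - D * ln 2 \<le> - L"
      using mult_left_mono[of "2/3" "ln 2" "6 * L"] L by (simp add: D_def)
    then have "exp (q * n) * 2 powr (- D) \<le> exp (- L)"
      by (simp add: powr_def qn mult_exp_exp)
    then have "real n * (exp (q * n) * 2 powr (- D)) \<le> X * exp (- L)"
      using n n0 by (intro mult_mono) auto
    then have "real n * exp (q * n) * 2 powr (- D) \<le> 1 / 10" using A by (simp add: mult_ac)
    then have "real n * exp (q * n) * 2 powr (- D) * ?Z \<le> 1 / 10 * ?Z"
      using q by (intro mult_right_mono) auto
    then show ?thesis using weight_large_degree[OF q(1), of n D] by linarith
  qed

  have balls: "(\<Sum>E | E \<in> {E. E \<subseteq> pairs n \<and> (\<forall>u. real (card {e \<in> E. u \<in> e}) \<le> D)} \<and>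
      n < 6 * card {v. v < n \<and> bad r E v}. q ^ card E) \<le> 6 * ((3 / 10) ^ 3 / (1 - 3 / 10)) * ?Z"
  proof (rule weight_many_bad)
    have "2 * (q * (1 + D) ^ r) * real n = D * (1 + D) ^ r" by (simp add: D_def q_def) (use n0 in simp)
    also have "\<dots> \<le> (1 + D) * (1 + D) ^ r" using L by (intro mult_right_mono) (auto simp: D_def)
    also have "\<dots> = (1 + D) ^ (r + 1)" by simp
    also have "\<dots> \<le> (7 / 10 * (10 * L)) ^ (r + 1)" using L by (intro power_mono) (auto simp: D_def)
    also have "\<dots> = (7 / 10) ^ (r + 1) * X" unfolding X_def by (rule power_mult_distrib)
    also have "\<dots> \<le> (7 / 10) ^ 2 * X"
      using r L by (intro mult_right_mono power_decreasing) (auto simp: X_def)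
    also have "\<dots> \<le> 3 / 5 * real n"
      using n XL L by (simp add: power2_eq_square)
    finally show "q * (1 + D) ^ r \<le> 3 / 10" using n0 by simp
  qed (use q L in \<open>auto simp: D_def\<close>)

  have colorings: "(\<Sum>E | E \<subseteq> pairs n \<and> (\<exists>g. almost_coloring n l g \<and> E \<inter> monochromatic n l g = {}). q ^ card E)
      \<le> 1 / 10 * ?Z"
  proof -
    define m where "m = (25 * real n ^ 2 / (36 * real l) - real n) / 2"
    have mq: "m * q = n * (25 / 24 * ln (real l) - q / 2)"
    proof -
      have "m * q = (25 * real n / (36 * real l) - 1) / 2 * (q * real n)"
        by (simp add: m_def power2_eq_square field_simps)
      also have "\<dots> = (25 * real n * ln (real l) / 12 - q * real n) / 2"
        unfolding qn using l by (simp add: L_def field_simps)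
      finally show ?thesis by (simp add: field_simps)
    qed
    have "0 \<le> ln (real l + 1)" by simp
    then have "0 \<le> (25 / 24 * ln (real l) - 1 / 100) / (51 / 50)" using C by linarith
    then have pos: "0 \<le> 25 / 24 * ln (real l) - 1 / 100" by (simp only: zero_le_divide_iff) auto
    \<comment> \<open>Logarithms of the two factors: \<open>m * ln (1 + q)\<close> exceeds \<open>n * ln (l + 1)\<close> by at least \<open>10 * n\<close>.\<close>
    have "n * (ln (real l + 1) + 10) \<le> n * ((25 / 24 * ln (real l) - 1 / 100) / (51 / 50))"
      using C by (intro mult_left_mono) auto
    also have "\<dots> \<le> n * ((25 / 24 * ln (real l) - q / 2) / (1 + q))"
      using q pos by (intro mult_left_mono frac_le) auto
    also have "\<dots> = m * (q / (1 + q))" using mq by simp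
    also have "\<dots> \<le> m * ln (1 + q)"
    proof (rule mult_left_mono)
      have "0 \<le> n * (25 / 24 * ln (real l) - q / 2)" using pos q by (intro mult_nonneg_nonneg) auto
      then have "0 \<le> m * q" using mq by simp
      moreover have "0 < q" using L n0 by (simp add: q_def)
      ultimately show "0 \<le> m" by (simp add: zero_le_mult_iff)
      have "ln (inverse (1 + q)) \<le> inverse (1 + q) - 1" using q by (intro ln_le_minus_one) auto
      moreover have "q / (1 + q) = 1 - inverse (1 + q)" using q by (simp add: field_simps)
      ultimately show "q / (1 + q) \<le> ln (1 + q)" using q by (simp add: ln_inverse)
    qed
    finally have "n * ln (real l + 1) - m * ln (1 + q) \<le> - (10 * n)" by (simp add: algebra_simps)
    then have "exp (n * ln (real l + 1) - m * ln (1 + q)) \<le> exp (- 10)"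
      using n0 by simp
    also have "\<dots> \<le> (1 / 10 :: real)"
      using exp_ge_add_one_self[of 10] by (simp add: exp_minus field_simps)
    also have "exp (n * ln (real l + 1) - m * ln (1 + q)) = (real l + 1) ^ n * (1 + q) powr (- m)"
    proof -
      have "exp (n * ln (real l + 1)) = (real l + 1) ^ n" by (simp add: exp_of_nat_mult)
      moreover have "exp (- (m * ln (1 + q))) = (1 + q) powr (- m)" using q by (simp add: powr_def)
      ultimately show ?thesis by (metis add_uminus_conv_diff exp_add)
    qed
    finally have "(real l + 1) ^ n * (1 + q) powr (- m) * ?Z \<le> 1 / 10 * ?Z"
      using q by (intro mult_right_mono) auto
    then show ?thesis using weight_almost_colorable[OF q(1) l, of n] unfolding m_def by linarith
  qed

  let ?S1 = "{E. E \<subseteq> pairs n \<and> (\<exists>v<n. D < real (card {e \<in> E. v \<in> e}))}"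
  let ?S2 = "{E. E \<in> {E. E \<subseteq> pairs n \<and> (\<forall>u. real (card {e \<in> E. u \<in> e}) \<le> D)} \<and>
      n < 6 * card {v. v < n \<and> bad r E v}}"
  let ?S3 = "{E. E \<subseteq> pairs n \<and> (\<exists>g. almost_coloring n l g \<and> E \<inter> monochromatic n l g = {})}"
  have fin: "finite ?S1" "finite ?S2" "finite ?S3"
    by (auto intro!: finite_subset[of _ "Pow (pairs n)"])
  have "Pow (pairs n) \<subseteq> ?S1 \<union> ?S2 \<union> ?S3"
  proof
    fix E assume E: "E \<in> Pow (pairs n)"
    have "\<And>e. e \<in> E \<Longrightarrow> e \<subseteq> {..<n}" using E by (auto simp: pairs_def)
    then have "{e \<in> E. v \<in> e} = {}" if "n \<le> v" for v using that by fastforce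
    note isolated = this
    have "real (card {e \<in> E. v \<in> e}) \<le> D" if "n \<le> v" for v
      unfolding isolated[OF that] using L by (simp add: D_def)
    then have "(\<forall>u. real (card {e \<in> E. u \<in> e}) \<le> D) \<or> (\<exists>v<n. D < real (card {e \<in> E. v \<in> e}))"
      by (meson not_le)
    then show "E \<in> ?S1 \<union> ?S2 \<union> ?S3" using E none by (auto simp: not_less)
  qed
  then have "(\<Sum>E\<in>Pow (pairs n). q ^ card E) \<le> (\<Sum>E\<in>?S1 \<union> ?S2 \<union> ?S3. q ^ card E)"
    using fin q by (intro sum_mono2) auto
  also have "\<dots> \<le> (\<Sum>E\<in>?S1 \<union> ?S2. q ^ card E) + (\<Sum>E\<in>?S3. q ^ card E)"
    using fin q by (subst sum.union_inter[symmetric]) (auto intro!: sum_nonneg)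
  also have "(\<Sum>E\<in>?S1 \<union> ?S2. q ^ card E) \<le> (\<Sum>E\<in>?S1. q ^ card E) + (\<Sum>E\<in>?S2. q ^ card E)"
    using fin q by (subst sum.union_inter[symmetric]) (auto intro!: sum_nonneg)
  finally have "(\<Sum>E\<in>Pow (pairs n). q ^ card E)
      \<le> 1 / 10 * ?Z + 6 * ((3 / 10) ^ 3 / (1 - 3 / 10)) * ?Z + 1 / 10 * ?Z"
    using degrees balls colorings by linarith
  moreover have "0 < ?Z" using q by simp
  ultimately show False by (simp add: sum_power_card_Pow power3_eq_cube)
qed

theorem theorem4p1:
  fixes r :: nat
  assumes "r > 0"
  shows "\<exists>l0 :: nat. \<forall>l :: nat. l > l0 \<longrightarrow>
    ereal_of_enat (f_loc 4 l r) < ereal ((10 * real l * ln (real l)) ^ (r + 1))"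
proof -
  obtain l0 where l0: "\<And>l. l0 \<le> l \<Longrightarrow> 2 \<le> real l * ln (real l) \<and>
    (10 * (real l * ln (real l))) ^ (r + 1) * exp (- (real l * ln (real l))) \<le> 1 / 10 \<and>
    ln (real l + 1) + 10 \<le> (25 / 24 * ln (real l) - 1 / 100) / (51 / 50)"
    using eventually_parameter_bounds[of r] by (auto simp: eventually_sequentially)
  show ?thesis
  proof (intro exI allI impI)
    fix l assume "l0 < l"
    define X where "X = (10 * (real l * ln (real l))) ^ (r + 1)"
    define n where "n = nat \<lfloor>X\<rfloor>"
    note num = l0[OF less_imp_le[OF \<open>l0 < l\<close>]]
    then have X: "1 \<le> X" unfolding X_def by (intro one_le_power) auto
    then have n: "real n \<le> X" "X - 1 \<le> real n" "0 < n"
      by (auto simp: n_def)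
    obtain E where E: "E \<subseteq> pairs n" "6 * card {v. v < n \<and> bad r E v} \<le> n"
      "\<And>g. almost_coloring n l g \<Longrightarrow> E \<inter> monochromatic n l g \<noteq> {}"
      using ex_good_edge_set[OF assms, of l n] num n(1,2) unfolding X_def by meson
    have "\<not> local_forces_colorable 4 l r m" if "n \<le> m" for m
      using not_local_forces_colorable[OF E(1) that _ E(2,3)] that n(3) by simp
    then have "f_loc 4 l r < enat n" by (rule f_loc_less)
    then obtain k where "f_loc 4 l r = enat k" "k < n" by (cases "f_loc 4 l r") auto
    then have "ereal_of_enat (f_loc 4 l r) < ereal (real n)" by simp
    also have "\<dots> \<le> ereal ((10 * real l * ln (real l)) ^ (r + 1))"
      using n(1) by (simp add: X_def mult.assoc)
    finally show "ereal_of_enat (f_loc 4 l r) < ereal ((10 * real l * ln (real l)) ^ (r + 1))" .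
  qed
qed

end
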